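(* Let $n \ge 1$ and let $P$ be a non-trivial product distribution on $\{0,1\}^n$. Then for every antichain $A \subset \{0,1\}^n$, $$\sum_{\ell=0}^n \Pr_{z \sim P}\big[z \in A \,\big|\, |z|=\ell\big]\leq 1.$$
   Context: Elements of $\{0,1\}^n$ are identified with subsets of $[n]=\{1,\ldots,n\}$, and $|z|$ denotes the number of coordinates of $z$ equal to $1$. An antichain is a family $A \subset \{0,1\}^n$ containing no two sets with one strictly contained in the other. A product distribution $P$ on $\{0,1\}^n$ is one under which the coordinates $z_1,\ldots,z_n$ are independent; write $p_j = \Pr_{z \sim P}[z_j = 1]$. $P$ is called non-trivial if $p_j(1-p_j) > 0$ for all $j \in [n]$ (so every conditioning event $|z|=\ell$ has positive probability). *)

theory Defs
  imports "HOL-Probability.Probability"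
begin

text \<open>
  Points of the cube are the subsets of \<open>{1..n}\<close>: coordinate \<open>j\<close> of \<open>z\<close> is the truth value of
  \<open>j \<in> z\<close>, and the number of coordinates equal to 1 is \<open>card z\<close>.
\<close>

definition cube :: "nat \<Rightarrow> nat set set" where
  "cube n = Pow {1..n}"

definition antichain :: "nat set set \<Rightarrow> bool" where
  "antichain A \<longleftrightarrow> (\<forall>x\<in>A. \<forall>y\<in>A. \<not> x \<subset> y)"

text \<open>
  A distribution on the cube is a probability mass function on sets of naturals that is
  supported inside \<open>cube n\<close>; the support need not be the whole cube.
\<close>

definition product_distribution :: "nat \<Rightarrow> nat set pmf \<Rightarrow> bool" where
  "product_distribution n P \<longleftrightarrow>
     set_pmf P \<subseteq> cube n \<and>
     prob_space.indep_vars (measure_pmf P) (\<lambda>_. count_space (UNIV :: bool set)) (\<lambda>j z. j \<in> z) {1..n}"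

definition coord_prob :: "nat set pmf \<Rightarrow> nat \<Rightarrow> real" where
  "coord_prob P j = \<P>(z in measure_pmf P. j \<in> z)"

definition nontrivial :: "nat \<Rightarrow> nat set pmf \<Rightarrow> bool" where
  "nontrivial n P \<longleftrightarrow> (\<forall>j\<in>{1..n}. coord_prob P j * (1 - coord_prob P j) > 0)"

end

theory Submission
  imports Defs
begin

text \<open>
  Weighted LYM argument. For an up-set \<open>U\<close>, the conditional probability of \<open>U\<close> given
  \<open>|z| = l\<close> is nondecreasing in \<open>l\<close>: this is shown by induction on the ground set, splitting on
  one coordinate and using that the level weights form a log-concave sequence.
  Apply it to the up-set \<open>U\<close> generated by the members of the antichain of size at most \<open>l\<close>.
  On level \<open>l + 1\<close> this up-set is disjoint from the antichain, so pushing \<open>U\<close> up one level makes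
  room for the next layer of the antichain, and the sum of the layer probabilities never
  exceeds the probability of an up-set.
\<close>

section \<open>Weights of sets and of levels\<close>

text \<open>The value \<open>u j b\<close> is the factor for coordinate \<open>j\<close> having
  truth value \<open>b\<close>. It is left unnormalised: rescaling a coordinate cancels in ratios of
  level weights.\<close>

definition weight :: "('a \<Rightarrow> bool \<Rightarrow> real) \<Rightarrow> 'a set \<Rightarrow> 'a set \<Rightarrow> real" where
  "weight u I S = (\<Prod>j\<in>I. u j (j \<in> S))"

definition level :: "'a set \<Rightarrow> 'a set set \<Rightarrow> nat \<Rightarrow> 'a set set" where
  "level I U l = {S. S \<subseteq> I \<and> S \<in> U \<and> card S = l}"

text \<open>For finite \<open>I\<close> and \<open>U = UNIV\<close> this is the coefficient of
  \<open>t ^ l\<close> in the product over \<open>j\<close> of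
  \<open>u j False + u j True * t\<close>.\<close>

definition level_weight :: "('a \<Rightarrow> bool \<Rightarrow> real) \<Rightarrow> 'a set \<Rightarrow> 'a set set \<Rightarrow> nat \<Rightarrow> real" where
  "level_weight u I U l = sum (weight u I) (level I U l)"

text \<open>Closure is under all supersets, not only those inside a ground set, so the notion stays
  the same while an induction changes the ground set.\<close>

definition upset :: "'a set set \<Rightarrow> bool" where
  "upset U \<longleftrightarrow> (\<forall>S T. S \<in> U \<longrightarrow> S \<subseteq> T \<longrightarrow> T \<in> U)"

lemma finite_level: "finite I \<Longrightarrow> finite (level I U l)"
  by (rule finite_subset[of _ "Pow I"]) (auto simp: level_def)

lemma weight_pos:
  assumes "\<And>j b. j \<in> I \<Longrightarrow> u j b > 0"
  shows "weight u I S > 0"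
  unfolding weight_def using assms by (intro prod_pos) auto

lemma level_weight_nonneg:
  assumes "\<And>j b. j \<in> I \<Longrightarrow> u j b > 0"
  shows "level_weight u I U l \<ge> 0"
  unfolding level_weight_def by (intro sum_nonneg less_imp_le weight_pos assms)

lemma sum_weight_mono:
  assumes "\<And>j b. j \<in> I \<Longrightarrow> u j b > 0" "finite Y" "X \<subseteq> Y"
  shows "sum (weight u I) X \<le> sum (weight u I) Y"
  using assms(2,3) by (rule sum_mono2) (simp add: weight_pos[OF assms(1)] less_imp_le)

lemma level_weight_mono:
  assumes "finite I" "\<And>j b. j \<in> I \<Longrightarrow> u j b > 0" "U \<subseteq> V"
  shows "level_weight u I U l \<le> level_weight u I V l"
  unfolding level_weight_def using assms(3)
  by (intro sum_weight_mono finite_level assms(1,2)) (auto simp: level_def)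

lemma level_weight_pos:
  assumes "finite I" "\<And>j b. j \<in> I \<Longrightarrow> u j b > 0" "l \<le> card I"
  shows "level_weight u I UNIV l > 0"
proof -
  obtain S where "S \<subseteq> I" "card S = l"
    using obtain_subset_with_card_n[OF assms(3)] by blast
  then have "level I UNIV l \<noteq> {}"
    by (auto simp: level_def)
  then show ?thesis
    unfolding level_weight_def
    by (intro sum_pos finite_level assms(1) weight_pos assms(2))
qed

lemma level_weight_beyond:
  assumes "finite I" "card I < l"
  shows "level_weight u I U l = 0"
proof -
  have "level I U l = {}"
    using assms by (auto simp: level_def dest: card_mono[OF assms(1)])
  then show ?thesis
    by (simp add: level_weight_def)
qed

section \<open>Splitting off one coordinate\<close>

lemma weight_insert_notin:
  assumes "finite I" "x \<notin> I" "S \<subseteq> I"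
  shows "weight u (insert x I) S = u x False * weight u I S"
proof -
  have "x \<notin> S"
    using assms by blast
  then show ?thesis
    using assms by (simp add: weight_def)
qed

lemma weight_insert_in:
  assumes "finite I" "x \<notin> I" "S \<subseteq> I"
  shows "weight u (insert x I) (insert x S) = u x True * weight u I S"
proof -
  have "(\<Prod>j\<in>I. u j (j \<in> insert x S)) = (\<Prod>j\<in>I. u j (j \<in> S))"
  proof (intro prod.cong refl)
    fix j
    assume "j \<in> I"
    then have "(j \<in> insert x S) = (j \<in> S)"
      using assms(2) by auto
    then show "u j (j \<in> insert x S) = u j (j \<in> S)"
      by simp
  qed
  then show ?thesis
    using assms by (simp add: weight_def)
qed

lemma level_weight_insert_0:
  assumes "finite I" "x \<notin> I"
  shows "level_weight u (insert x I) U 0 = u x False * level_weight u I U 0"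
proof -
  have "level (insert x I) U 0 = level I U 0"
    using assms by (auto simp: level_def card_eq_0_iff dest: finite_subset)
  then show ?thesis
    using assms by (auto simp: level_weight_def sum_distrib_left level_def weight_insert_notin
        intro!: sum.cong)
qed

text \<open>Sets avoiding \<open>x\<close> keep their size; sets containing \<open>x\<close>
  correspond, by deleting it, to sets of size \<open>l\<close> in the link of \<open>x\<close>. The
  link of \<open>UNIV\<close> is again \<open>UNIV\<close>.\<close>

lemma level_weight_insert_Suc:
  assumes "finite I" "x \<notin> I"
  shows "level_weight u (insert x I) U (Suc l) =
    u x False * level_weight u I U (Suc l) + u x True * level_weight u I {S. insert x S \<in> U} l"
proof -
  let ?A = "level I U (Suc l)" and ?B = "level I {S. insert x S \<in> U} l"
  have *: "T \<in> insert x ` ?B" if T: "T \<in> level (insert x I) U (Suc l)" "T \<notin> ?A" for T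
  proof -
    have "x \<in> T" "finite T" "T - {x} \<subseteq> I"
      using T assms by (auto simp: level_def dest: finite_subset)
    then have "insert x (T - {x}) = T" "T - {x} \<in> ?B"
      using T by (auto simp: level_def insert_absorb)
    then show ?thesis
      by (metis imageI)
  qed
  have "insert x ` ?B \<subseteq> level (insert x I) U (Suc l)"
  proof
    fix T
    assume "T \<in> insert x ` ?B"
    then obtain S where S: "T = insert x S" "S \<subseteq> I" "insert x S \<in> U" "card S = l"
      by (auto simp: level_def)
    then have "finite S" "x \<notin> S"
      using assms by (auto dest: finite_subset)
    with S show "T \<in> level (insert x I) U (Suc l)"
      by (auto simp: level_def)
  qed
  with * have split: "level (insert x I) U (Suc l) = ?A \<union> insert x ` ?B"
    by (auto simp: level_def)
  have "?A \<inter> insert x ` ?B = {}"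
    using assms by (auto simp: level_def)
  then have "level_weight u (insert x I) U (Suc l) =
      sum (weight u (insert x I)) ?A + sum (weight u (insert x I)) (insert x ` ?B)"
    unfolding level_weight_def split using assms
    by (intro sum.union_disjoint finite_imageI finite_level)
  moreover have "sum (weight u (insert x I)) ?A = u x False * level_weight u I U (Suc l)"
    unfolding level_weight_def sum_distrib_left
    by (intro sum.cong weight_insert_notin assms) (auto simp: level_def)
  moreover have "inj_on (insert x) ?B"
    using assms by (auto simp: inj_on_def level_def)
  then have "sum (weight u (insert x I)) (insert x ` ?B) =
      (\<Sum>S\<in>?B. weight u (insert x I) (insert x S))"
    by (rule sum.reindex_cong) auto
  then have "sum (weight u (insert x I)) (insert x ` ?B) =
      u x True * level_weight u I {S. insert x S \<in> U} l"
    unfolding level_weight_def sum_distrib_left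
    using weight_insert_in[OF assms, of _ u] by (auto simp: level_def intro!: sum.cong)
  ultimately show ?thesis
    by simp
qed

section \<open>Log-concavity and monotone level ratios\<close>

text \<open>A new coordinate multiplies the generating polynomial by a linear factor; both sides are
  then compared coefficientwise as quadratic forms in \<open>?q\<close> and
  \<open>?p\<close>.\<close>

lemma level_weight_log_concave:
  assumes "finite I" "\<And>j b. j \<in> I \<Longrightarrow> u j b > 0"
  shows "level_weight u I UNIV l * level_weight u I UNIV (Suc (Suc l)) \<le>
    (level_weight u I UNIV (Suc l))\<^sup>2"
  using assms
proof (induction I arbitrary: l rule: finite_induct)
  case empty
  then show ?case
    by (simp add: level_weight_beyond)
next
  case (insert x I)
  let ?e = "level_weight u I UNIV" and ?q = "u x False" and ?p = "u x True"
  have pos: "?q > 0" "?p > 0" and pos': "\<And>j b. j \<in> I \<Longrightarrow> u j b > 0"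
    using insert.prems by auto
  have nn: "?e k \<ge> 0" for k
    using level_weight_nonneg pos' by blast
  have IH: "?e k * ?e (Suc (Suc k)) \<le> (?e (Suc k))\<^sup>2" for k
    using insert.IH pos' by blast
  show ?case
  proof (cases l)
    case 0
    have "?q\<^sup>2 * (?e 0 * ?e 2) \<le> ?q\<^sup>2 * (?e 1)\<^sup>2"
      using IH[of 0] by (intro mult_left_mono) (auto simp: numeral_2_eq_2)
    moreover have "0 \<le> ?q * ?p * (?e 0 * ?e 1)" "0 \<le> ?p\<^sup>2 * (?e 0)\<^sup>2"
      using pos nn by simp_all
    ultimately show ?thesis
      using insert.hyps 0 unfolding numeral_2_eq_2
      by (simp add: level_weight_insert_0 level_weight_insert_Suc power2_eq_square algebra_simps)
  next
    case (Suc k)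
    let ?a = "?e k" and ?b = "?e (Suc k)" and ?c = "?e (Suc (Suc k))"
      and ?d = "?e (Suc (Suc (Suc k)))"
    \<comment> \<open>This is the coefficient of \<open>?q * ?p\<close>. Multiplying two consecutive
      instances of \<open>IH\<close> gives it times \<open>?b * ?c\<close>, which can be cancelled
      while the level of \<open>?d\<close> exists; beyond the top level \<open>?d\<close> is
      0.\<close>
    have ad: "?a * ?d \<le> ?b * ?c"
    proof (cases "Suc (Suc (Suc k)) \<le> card I")
      case True
      then have bc: "?b > 0" "?c > 0"
        using level_weight_pos[OF insert.hyps(1) pos'] by auto
      have "(?a * ?c) * (?b * ?d) \<le> ?b\<^sup>2 * ?c\<^sup>2"
        using IH[of k] IH[of "Suc k"] nn by (intro mult_mono) auto
      then have "(?a * ?d) * (?b * ?c) \<le> (?b * ?c) * (?b * ?c)"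
        by (simp add: power2_eq_square algebra_simps)
      then show ?thesis
        using bc by (meson mult_le_cancel_right_pos mult_pos_pos)
    next
      case False
      then show ?thesis
        using insert.hyps nn by (simp add: level_weight_beyond)
    qed
    have "?q\<^sup>2 * (?b * ?d) \<le> ?q\<^sup>2 * ?c\<^sup>2" "?p\<^sup>2 * (?a * ?c) \<le> ?p\<^sup>2 * ?b\<^sup>2"
      "?q * ?p * (?a * ?d) \<le> ?q * ?p * (?b * ?c)"
      using IH ad pos by (auto intro!: mult_left_mono)
    then show ?thesis
      using insert.hyps Suc
      by (simp add: level_weight_insert_Suc power2_eq_square algebra_simps)
  qed
qed

text \<open>
  Division-free form of the monotonicity in \<open>l\<close> of
  \<open>level_weight u I U l / level_weight u I UNIV l\<close>; it also makes sense for \<open>l \<ge> card I\<close>.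
\<close>

lemma level_weight_upset_mono:
  assumes "finite I" "\<And>j b. j \<in> I \<Longrightarrow> u j b > 0" "upset U"
  shows "level_weight u I U l * level_weight u I UNIV (Suc l) \<le>
    level_weight u I U (Suc l) * level_weight u I UNIV l"
  using assms
proof (induction I arbitrary: U l rule: finite_induct)
  case empty
  then show ?case
    by (simp add: level_weight_beyond)
next
  case (insert x I)
  let ?V = "{S. insert x S \<in> U}"
  let ?e = "level_weight u I UNIV" and ?a = "level_weight u I U" and ?b = "level_weight u I ?V"
    and ?q = "u x False" and ?p = "u x True"
  have pos: "?q > 0" "?p > 0" and pos': "\<And>j b. j \<in> I \<Longrightarrow> u j b > 0"
    using insert.prems by auto
  \<comment> \<open>\<open>?V\<close> is the link of \<open>x\<close>. Being an up-set itself, it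
    falls under the induction hypothesis just as \<open>U\<close> does.\<close>
  have V: "upset ?V" "U \<subseteq> ?V"
    using insert.prems(2) unfolding upset_def by blast+
  have nn: "level_weight u I W k \<ge> 0" for W k
    using level_weight_nonneg pos' by blast
  have ab: "?a k \<le> ?b k" for k
    using level_weight_mono[OF insert.hyps(1) pos' V(2)] .
  have IHa: "?a k * ?e (Suc k) \<le> ?a (Suc k) * ?e k" for k
    using insert.IH pos' insert.prems(2) by blast
  have IHb: "?b k * ?e (Suc k) \<le> ?b (Suc k) * ?e k" for k
    using insert.IH pos' V(1) by blast
  show ?case
  proof (cases l)
    case 0
    \<comment> \<open>At level 0 the mixed coefficient needs only \<open>ab\<close>.\<close>
    have "?q\<^sup>2 * (?a 0 * ?e 1) \<le> ?q\<^sup>2 * (?a 1 * ?e 0)"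
      "?q * ?p * (?a 0 * ?e 0) \<le> ?q * ?p * (?b 0 * ?e 0)"
      using IHa[of 0] ab[of 0] nn pos by (auto intro!: mult_left_mono mult_right_mono)
    then show ?thesis
      using insert.hyps 0
      by (simp add: level_weight_insert_0 level_weight_insert_Suc power2_eq_square algebra_simps)
  next
    case (Suc k)
    let ?k1 = "Suc k" and ?k2 = "Suc (Suc k)"
    \<comment> \<open>The coefficient of \<open>?q * ?p\<close>, obtained after multiplying by
      \<open>?e ?k1\<close>: log-concavity weighted by the nonnegative gap
      \<open>?b ?k1 - ?a ?k1\<close> supplies what \<open>IHa\<close> times \<open>?e k\<close> and
      \<open>IHb\<close> times \<open>?e ?k2\<close> leave open. Beyond the top level both sides
      vanish.\<close>
    have mid: "?a ?k1 * ?e ?k1 + ?b k * ?e ?k2 \<le> ?a ?k2 * ?e k + ?b ?k1 * ?e ?k1"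
    proof (cases "?k1 \<le> card I")
      case True
      then have e1: "?e ?k1 > 0"
        using insert.hyps(1) by (intro level_weight_pos pos')
      have "0 \<le> (?b ?k1 - ?a ?k1) * ((?e ?k1)\<^sup>2 - ?e k * ?e ?k2)"
        using ab level_weight_log_concave[OF insert.hyps(1) pos'] by simp
      moreover have "(?a ?k1 * ?e ?k2) * ?e k \<le> (?a ?k2 * ?e ?k1) * ?e k"
        "(?b k * ?e ?k1) * ?e ?k2 \<le> (?b ?k1 * ?e k) * ?e ?k2"
        using IHa IHb nn by (auto intro!: mult_right_mono)
      ultimately have "(?a ?k1 * ?e ?k1 + ?b k * ?e ?k2) * ?e ?k1
          \<le> (?a ?k2 * ?e k + ?b ?k1 * ?e ?k1) * ?e ?k1"
        by (simp add: power2_eq_square algebra_simps)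
      with e1 show ?thesis
        by (meson mult_le_cancel_right_pos)
    next
      case False
      then show ?thesis
        using insert.hyps by (simp add: level_weight_beyond)
    qed
    have "?q\<^sup>2 * (?a ?k1 * ?e ?k2) \<le> ?q\<^sup>2 * (?a ?k2 * ?e ?k1)"
      "?p\<^sup>2 * (?b k * ?e ?k1) \<le> ?p\<^sup>2 * (?b ?k1 * ?e k)"
      "?q * ?p * (?a ?k1 * ?e ?k1 + ?b k * ?e ?k2) \<le>
        ?q * ?p * (?a ?k2 * ?e k + ?b ?k1 * ?e ?k1)"
      using IHa IHb mid pos by (auto intro!: mult_left_mono)
    then show ?thesis
      using insert.hyps Suc
      by (simp add: level_weight_insert_Suc power2_eq_square algebra_simps)
  qed
qed

section \<open>The LYM inequality for positive weights\<close>

lemma weighted_LYM: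
  assumes "finite I" and pos: "\<And>j b. j \<in> I \<Longrightarrow> u j b > 0"
    and anti: "\<And>S T. S \<in> A \<Longrightarrow> T \<in> A \<Longrightarrow> \<not> S \<subset> T"
  shows "(\<Sum>l=0..card I. level_weight u I A l / level_weight u I UNIV l) \<le> 1"
proof -
  \<comment> \<open>An infinite \<open>S\<close> has \<open>card S = 0\<close> and so passes the
    size test, but it lies below no subset of the finite \<open>I\<close> and leaves the levels
    unaffected.\<close>
  define U where "U l = {T. \<exists>S\<in>A. S \<subseteq> T \<and> card S \<le> l}" for l
  let ?e = "level_weight u I UNIV" and ?a = "level_weight u I A"
  have up: "upset (U l)" for l
    unfolding upset_def U_def by blast
  have e: "?e l > 0" if "l \<le> card I" for l
    using assms(1) that by (intro level_weight_pos pos)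
  have step: "?a (Suc l) + level_weight u I (U l) (Suc l) \<le> level_weight u I (U (Suc l)) (Suc l)"
    for l
  proof -
    have "level I A (Suc l) \<inter> level I (U l) (Suc l) = {}"
    proof -
      \<comment> \<open>The sizes rule out \<open>S = T\<close>, so the inclusion would be strict
        within \<open>A\<close>.\<close>
      have False if T: "T \<in> A" "card T = Suc l" and S: "S \<in> A" "S \<subseteq> T" "card S \<le> l" for S T
        using anti[OF S(1) T(1)] T S by (cases "S = T") auto
      then show ?thesis
        unfolding level_def U_def by blast
    qed
    then have "?a (Suc l) + level_weight u I (U l) (Suc l) =
        sum (weight u I) (level I A (Suc l) \<union> level I (U l) (Suc l))"
      unfolding level_weight_def using assms(1)
      by (intro sum.union_disjoint[symmetric] finite_level)
    also have "\<dots> \<le> level_weight u I (U (Suc l)) (Suc l)"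
      unfolding level_weight_def
    proof (intro sum_weight_mono finite_level assms(1) pos)
      show "level I A (Suc l) \<union> level I (U l) (Suc l) \<subseteq> level I (U (Suc l)) (Suc l)"
        unfolding level_def U_def by (auto intro: le_SucI)
    qed
    finally show ?thesis .
  qed
  \<comment> \<open>Bounding by the share of \<open>U l\<close> instead of by 1 makes the induction
    work, since this share can be moved up a level.\<close>
  have "(\<Sum>i=0..l. ?a i / ?e i) \<le> level_weight u I (U l) l / ?e l" if "l \<le> card I" for l
    using that
  proof (induction l)
    case 0
    have "level I A 0 \<subseteq> level I (U 0) 0"
      unfolding level_def U_def by (auto intro: eq_imp_le)
    then have "?a 0 \<le> level_weight u I (U 0) 0"
      unfolding level_weight_def
      by (intro sum_weight_mono finite_level assms(1) pos)
    then show ?case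
      using e[of 0] by (simp add: divide_right_mono)
  next
    case (Suc l)
    have pos_e: "?e l > 0" "?e (Suc l) > 0"
      using e Suc.prems by auto
    have "level_weight u I (U l) l * ?e (Suc l) \<le> level_weight u I (U l) (Suc l) * ?e l"
      by (intro level_weight_upset_mono assms(1) pos up)
    then have "level_weight u I (U l) l / ?e l \<le> level_weight u I (U l) (Suc l) / ?e (Suc l)"
      using pos_e by (simp add: field_simps)
    then have "(\<Sum>i=0..Suc l. ?a i / ?e i) \<le>
        (?a (Suc l) + level_weight u I (U l) (Suc l)) / ?e (Suc l)"
      using Suc by (simp add: add_divide_distrib)
    also have "\<dots> \<le> level_weight u I (U (Suc l)) (Suc l) / ?e (Suc l)"
      using step pos_e by (intro divide_right_mono) auto
    finally show ?case .
  qed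
  from this[of "card I"] have "(\<Sum>i=0..card I. ?a i / ?e i) \<le>
      level_weight u I (U (card I)) (card I) / ?e (card I)"
    by simp
  also have "level_weight u I (U (card I)) (card I) \<le> ?e (card I)"
    by (intro level_weight_mono assms(1) pos subset_UNIV)
  then have "level_weight u I (U (card I)) (card I) / ?e (card I) \<le> 1"
    using e[of "card I"] by (simp add: divide_le_eq_1)
  finally show ?thesis .
qed

section \<open>From product distributions to weights\<close>

lemma pmf_product_distribution:
  assumes "product_distribution n P" "S \<in> cube n" "n \<ge> 1"
  shows "pmf P S =
    weight (\<lambda>j b. if b then coord_prob P j else 1 - coord_prob P j) {1..n} S"
proof -
  have supp: "set_pmf P \<subseteq> cube n"
    and indep: "prob_space.indep_vars (measure_pmf P) (\<lambda>_. count_space (UNIV :: bool set))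
      (\<lambda>j z. j \<in> z) {1..n}"
    using assms(1) by (auto simp: product_distribution_def)
  let ?X = "\<lambda>j. {z. (j \<in> z) = (j \<in> S)}"
  have "pmf P S = measure P ((\<Inter>j\<in>{1..n}. ?X j) \<inter> set_pmf P)"
  proof -
    \<comment> \<open>The cylinder also contains sets that differ from \<open>S\<close> outside
      \<open>{1..n}\<close>; the support excludes them.\<close>
    have "(\<Inter>j\<in>{1..n}. ?X j) \<inter> set_pmf P = {S} \<inter> set_pmf P"
      using supp assms(2) unfolding cube_def by blast
    then show ?thesis
      by (simp add: measure_Int_set_pmf pmf.rep_eq)
  qed
  also have "\<dots> = measure P (\<Inter>j\<in>{1..n}. (\<lambda>z. j \<in> z) -` {j \<in> S} \<inter> space P)"
    by (simp add: measure_Int_set_pmf vimage_def)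
  \<comment> \<open>The product rule asks for a nonempty index set, which is where
    \<open>n \<ge> 1\<close> enters.\<close>
  also have "\<dots> = (\<Prod>j\<in>{1..n}. measure P ((\<lambda>z. j \<in> z) -` {j \<in> S} \<inter> space P))"
    using assms(3) by (intro prob_space.indep_varsD[OF measure_pmf.prob_space_axioms indep]) auto
  also have "\<dots> = weight (\<lambda>j b. if b then coord_prob P j else 1 - coord_prob P j) {1..n} S"
    unfolding weight_def
  proof (intro prod.cong refl)
    fix j
    have "measure P {z. j \<notin> z} = 1 - measure P {z. j \<in> z}"
      using measure_pmf.prob_neg[of P "\<lambda>z. j \<in> z"] by simp
    then show "measure P ((\<lambda>z. j \<in> z) -` {j \<in> S} \<inter> space P) =
        (if j \<in> S then coord_prob P j else 1 - coord_prob P j)"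
      by (simp add: coord_prob_def vimage_def)
  qed
  finally show ?thesis .
qed

theorem theorem2:
  fixes n :: nat and P :: "nat set pmf" and A :: "nat set set"
  assumes "n \<ge> 1"
    and "product_distribution n P"
    and "nontrivial n P"
    and "A \<subseteq> cube n"
    and "antichain A"
  shows "(\<Sum>l=0..n. \<P>(z in measure_pmf P. z \<in> A \<bar> card z = l)) \<le> 1"
proof -
  let ?u = "\<lambda>j b. if b then coord_prob P j else 1 - coord_prob P j" and ?I = "{1..n}"
  have pos: "?u j b > 0" if "j \<in> ?I" for j b
  proof -
    have "coord_prob P j * (1 - coord_prob P j) > 0" "coord_prob P j \<ge> 0"
      using that assms(3) by (auto simp: nontrivial_def coord_prob_def)
    then show ?thesis
      by (auto simp: zero_less_mult_iff)
  qed
  \<comment> \<open>Taking \<open>U = A\<close> gives the numerator and \<open>U = UNIV\<close> the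
    denominator of the conditional probability.\<close>
  have prob: "\<P>(z in P. z \<in> U \<and> card z = l) = level_weight ?u ?I U l" for U l
  proof -
    have "\<P>(z in P. z \<in> U \<and> card z = l) = measure P ({z. z \<in> U \<and> card z = l} \<inter> set_pmf P)"
      by (simp add: measure_Int_set_pmf)
    also have "\<dots> = measure P (level ?I U l \<inter> set_pmf P)"
      using assms(2) by (intro arg_cong[of _ _ "measure P"])
        (auto simp: level_def product_distribution_def cube_def)
    also have "\<dots> = sum (pmf P) (level ?I U l)"
      by (simp add: measure_Int_set_pmf measure_measure_pmf_finite finite_level)
    also have "\<dots> = level_weight ?u ?I U l"
      unfolding level_weight_def
      by (intro sum.cong refl pmf_product_distribution assms(1,2)) (auto simp: level_def cube_def)
    finally show ?thesis .
  qed
  have "\<P>(z in measure_pmf P. z \<in> A \<bar> card z = l) =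
      level_weight ?u ?I A l / level_weight ?u ?I UNIV l" for l
    using prob[of A l] prob[of UNIV l] by (simp add: cond_prob_def)
  moreover have "(\<Sum>l=0..card ?I. level_weight ?u ?I A l / level_weight ?u ?I UNIV l) \<le> 1"
    using assms(5) by (intro weighted_LYM pos) (auto simp: antichain_def)
  ultimately show ?thesis
    by simp
qed

end
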